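(* Let $W$ be an infinite dihedral group with distinguished generators $S=\{s_1,s_2\}$. For $a\neq b$ in $S$ and $j>0$ let $\langle j,a,b]=\ldots ab$ denote the alternating product of $j$ factors $a,b$ whose last factor is $b$, let $(c_w)_{w\in W}$ be the Kazhdan-Lusztig basis of the Hecke algebra of $W$, and write $C_j=c_{\langle j,s_1,s_2]}$. Let $k>0$, let $s$ be the first factor of $\langle k,s_1,s_2]$ (i.e. $s=s_1$ if $k$ is even, $s=s_2$ if $k$ is odd), and let $t$ be the other element of $S$. Then, for every integer $i>0$, $$c_{\langle i,s,t]}\cdot C_k=\begin{cases}C_{k-i}+2C_{k-i+2}+\cdots+2C_{k+i-2}+C_{k+i}&(0<i<k)\\ 2C_2+2C_4+\cdots+2C_{2k-2}+C_{2k}&(i=k)\\ C_{i-k}+2C_{i-k+2}+\cdots+2C_{i+k-2}+C_{i+k}&(i>k)\end{cases}$$ (where for $k=1$ the entry for $i=k$ is interpreted as $C_2$), and $$c_{\langle i,t,s]}\cdot C_k=\begin{cases}(v+v^{-1})C_{k-i+1}+(v+v^{-1})C_{k-i+3}+\cdots+(v+v^{-1})C_{k+i-1}&(0<i\leq k)\\ (v+v^{-1})C_{i-k+1}+(v+v^{-1})C_{i-k+3}+\cdots+(v+v^{-1})C_{i+k-1}&(i\geq k)\end{cases}$$ In all these sums the indices increase in steps of $2$; in the first set of formulas the first and last terms have coefficient $1$ and all intermediate ones coefficient $2$ (except that for $i=k$ all terms but the last have coefficient $2$). The same formulas hold with the roles of $s_1$ and $s_2$ exchanged, i.e. with $c_{\langle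 j,s_1,s_2]}$ replaced by $c_{\langle j,s_2,s_1]}$ throughout and $s$ the first factor of $\langle k,s_2,s_1]$.
   Context: For a Coxeter group $(W,S)$ with Bruhat order $\leq$, let $A=\mathbf{Z}[v,v^{-1}]$ with $v$ an indeterminate. The Hecke algebra $\mathcal{H}$ is the free $A$-module with basis $(t_y)_{y\in W}$, with the unique associative $A$-algebra structure such that, for $s\in S$ and $y\in W$, $$t_s t_y=\begin{cases}t_{sy}&\text{if } sy>y,\\ (v-v^{-1})t_y+t_{sy}&\text{if } sy<y.\end{cases}$$ There is a unique ring involution $i$ of $\mathcal{H}$ with $i(v)=v^{-1}$ and $i(t_y)=t_{y^{-1}}^{-1}$ for all $y\in W$. The Kazhdan-Lusztig basis of $\mathcal{H}$ is the unique family $(c_y)_{y\in W}$ such that $i(c_y)=c_y$ and $c_y=t_y+\sum_{x<y}p_{x,y}t_x$ with $p_{x,y}\in v^{-1}\mathbf{Z}[v^{-1}]$. (The involution $i$ is unrelated to the integer $i$ in the claim.) *)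

theory Defs
  imports Complex_Main "HOL-Algebra.Generated_Groups" "HOL-Library.Poly_Mapping"
begin

text \<open>
  The ring of integral Laurent polynomials is the group ring of the integers:
  finitely supported maps from exponents to coefficients with the convolution product
  of \<^theory>\<open>HOL-Library.Poly_Mapping\<close>.
\<close>

type_synonym laurent = "int \<Rightarrow>\<^sub>0 int"

definition v :: laurent where
  "v = Poly_Mapping.single 1 1"

definition v_inv :: laurent where
  "v_inv = Poly_Mapping.single (- 1) 1"

text \<open>The subset $v^{-1} {\bf Z}[v^{-1}]$: only negative exponents occur.\<close>

definition negative_laurent :: "laurent set" where
  "negative_laurent = {p. Poly_Mapping.keys p \<subseteq> {..<0}}"


definition word_length :: "('w, 'm) monoid_scheme \<Rightarrow> 'w set \<Rightarrow> 'w \<Rightarrow> nat" where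
  "word_length W S w =
     (LEAST n. \<exists>ws. set ws \<subseteq> S \<and> length ws = n \<and> foldr (\<otimes>\<^bsub>W\<^esub>) ws \<one>\<^bsub>W\<^esub> = w)"

definition reflections :: "('w, 'm) monoid_scheme \<Rightarrow> 'w set \<Rightarrow> 'w set" where
  "reflections W S = {w \<otimes>\<^bsub>W\<^esub> s \<otimes>\<^bsub>W\<^esub> inv\<^bsub>W\<^esub> w | w s. w \<in> carrier W \<and> s \<in> S}"

definition bruhat_step :: "('w, 'm) monoid_scheme \<Rightarrow> 'w set \<Rightarrow> 'w \<Rightarrow> 'w \<Rightarrow> bool" where
  "bruhat_step W S x y \<longleftrightarrow>
     x \<in> carrier W \<and> (\<exists>r \<in> reflections W S. y = x \<otimes>\<^bsub>W\<^esub> r) \<and> word_length W S x < word_length W S y"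

definition bruhat_le :: "('w, 'm) monoid_scheme \<Rightarrow> 'w set \<Rightarrow> 'w \<Rightarrow> 'w \<Rightarrow> bool" where
  "bruhat_le W S = (bruhat_step W S)\<^sup>*\<^sup>*"

definition bruhat_less :: "('w, 'm) monoid_scheme \<Rightarrow> 'w set \<Rightarrow> 'w \<Rightarrow> 'w \<Rightarrow> bool" where
  "bruhat_less W S x y \<longleftrightarrow> bruhat_le W S x y \<and> x \<noteq> y"


text \<open>
  The Hecke algebra of \<open>(W, S)\<close>: an associative unital ring (the type \<open>'h\<close>) that is an algebra
  over the Laurent polynomials through \<open>scale\<close> and is free as a module with basis \<open>(t y)\<close>
  indexed by the elements \<open>y\<close> of \<open>W\<close>.
\<close>

locale hecke_algebra = module scale
  for scale :: "laurent \<Rightarrow> 'h::ring_1 \<Rightarrow> 'h" (infixr \<open>*s\<close> 75) +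
  fixes W :: "('w, 'm) monoid_scheme" (structure)
    and S :: "'w set"
    and t :: "'w \<Rightarrow> 'h"
  assumes scale_mult_left: "(a *s g) * h = a *s (g * h)"
    and scale_mult_right: "g * (a *s h) = a *s (g * h)"
    and basis_inj: "inj_on t (carrier W)"
    and basis_independent: "independent (t ` carrier W)"
    and basis_span: "span (t ` carrier W) = UNIV"
    and mult_up: "\<lbrakk>s \<in> S; y \<in> carrier W; bruhat_less W S y (s \<otimes> y)\<rbrakk> \<Longrightarrow> t s * t y = t (s \<otimes> y)"
    and mult_down: "\<lbrakk>s \<in> S; y \<in> carrier W; bruhat_less W S (s \<otimes> y) y\<rbrakk> \<Longrightarrow>
      t s * t y = (v - v_inv) *s t y + t (s \<otimes> y)"

text \<open>
  The ring involution is called \<open>\<iota>\<close>; the value \<open>\<iota> (t y)\<close> is characterised as the two-sided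
  inverse of \<open>t (inv y)\<close>.
\<close>

locale hecke_involution = hecke_algebra scale W S t
  for scale :: "laurent \<Rightarrow> 'h::ring_1 \<Rightarrow> 'h" (infixr \<open>*s\<close> 75)
    and W :: "('w, 'm) monoid_scheme" (structure)
    and S :: "'w set"
    and t :: "'w \<Rightarrow> 'h" +
  fixes \<iota> :: "'h \<Rightarrow> 'h"
  assumes \<iota>_add: "\<iota> (g + h) = \<iota> g + \<iota> h"
    and \<iota>_mult: "\<iota> (g * h) = \<iota> g * \<iota> h"
    and \<iota>_one: "\<iota> 1 = 1"
    and \<iota>_invol: "\<iota> (\<iota> h) = h"
    and \<iota>_v: "\<iota> (v *s 1) = v_inv *s 1"
    and \<iota>_basis: "y \<in> carrier W \<Longrightarrow> \<iota> (t y) * t (inv y) = 1 \<and> t (inv y) * \<iota> (t y) = 1"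

locale kazhdan_lusztig_basis = hecke_involution scale W S t \<iota>
  for scale :: "laurent \<Rightarrow> 'h::ring_1 \<Rightarrow> 'h" (infixr \<open>*s\<close> 75)
    and W :: "('w, 'm) monoid_scheme" (structure)
    and S :: "'w set"
    and t :: "'w \<Rightarrow> 'h"
    and \<iota> :: "'h \<Rightarrow> 'h" +
  fixes c :: "'w \<Rightarrow> 'h"
  assumes c_invariant: "y \<in> carrier W \<Longrightarrow> \<iota> (c y) = c y"
    and c_unitriangular: "y \<in> carrier W \<Longrightarrow>
      \<exists>p. (\<forall>x. p x \<in> negative_laurent) \<and>
          c y = t y + (\<Sum>x\<in>{x \<in> carrier W. bruhat_less W S x y}. p x *s t x)"


locale infinite_dihedral = group W
  for W :: "('w, 'm) monoid_scheme" (structure) +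
  fixes s1 s2 :: 'w
  assumes s1_closed: "s1 \<in> carrier W" and s2_closed: "s2 \<in> carrier W"
    and s1_order: "s1 \<noteq> \<one>" "s1 \<otimes> s1 = \<one>"
    and s2_order: "s2 \<noteq> \<one>" "s2 \<otimes> s2 = \<one>"
    and generated: "generate W {s1, s2} = carrier W"
    and infinite_order: "n > 0 \<Longrightarrow> (s1 \<otimes> s2) [^] (n::nat) \<noteq> \<one>"

text \<open>The product $\langle j, a, b] = \ldots a b$ of \<open>j\<close> alternating factors ending in \<open>b\<close>.\<close>

primrec alt :: "('w, 'm) monoid_scheme \<Rightarrow> nat \<Rightarrow> 'w \<Rightarrow> 'w \<Rightarrow> 'w" where
  "alt W 0 a b = \<one>\<^bsub>W\<^esub>"
| "alt W (Suc j) a b = alt W j b a \<otimes>\<^bsub>W\<^esub> b"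

end

theory Submission
  imports Defs "HOL-Algebra.Multiplicative_Group"
begin

text \<open>
  The involution is unitriangular on the standard basis with respect to the length, so an invariant
  element with all coefficients in $v^{-1} {\bf Z}[v^{-1}]$ vanishes. Hence $c_w$ is the only invariant
  element of the form $t_w + \sum_x p_x t_x$ with $p_x \in v^{-1} {\bf Z}[v^{-1}]$. In the infinite
  dihedral group this element is $t_w + \sum_{l(x) < l(w)} v^{l(x) - l(w)} t_x$: the elements defined
  by this formula satisfy
  $c_s c_{\langle n, a, b]} = c_{\langle n + 1, a, b]} + c_{\langle n - 1, a, b]}$ for \<open>s\<close> the first
  factor of $\langle n + 1, a, b]$ and $n > 0$, with 0 in place of $c_{\langle 0, a, b]}$, and are therefore
  invariant by induction.

  Extending $C_n$ to an odd function of $n \in {\bf Z}$ makes this rule hold for all integers, and it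
  becomes a Chebyshev recurrence for the products $c_{\langle i, x, y]} C_k$ in \<open>i\<close>. Let
  $f(n) = (v + v^{-1}) C_n$ if \<open>y\<close> is the first factor of $\langle k, a, b]$, and
  $f(n) = C_{n - 1} + C_{n + 1}$ otherwise, so that $f(k) = c_y C_k$. Then
  $c_{\langle i, x, y]} C_k = f(k - i + 1) + f(k - i + 3) + \dots + f(k + i - 1)$. Since \<open>f\<close> is
  odd, this sum is symmetric in \<open>i\<close> and \<open>k\<close>, which gives the cases \<open>i > k\<close>.
\<close>

section \<open>Groups generated by involutions\<close>

lemma (in group) bruhat_less_left_mult:
  assumes "s \<in> S" "s \<in> carrier G" "w \<in> carrier G"
    and "word_length G S w < word_length G S (s \<otimes> w)"
  shows "bruhat_less G S w (s \<otimes> w)"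
proof -
  have "s \<otimes> w = w \<otimes> (inv w \<otimes> s \<otimes> inv (inv w))"
    using assms(2,3) by (simp flip: m_assoc)
  moreover have "inv w \<otimes> s \<otimes> inv (inv w) \<in> reflections G S"
    unfolding reflections_def using assms(1,3) inv_closed by blast
  ultimately have "bruhat_step G S w (s \<otimes> w)"
    unfolding bruhat_step_def using assms(3,4) by blast
  then show ?thesis
    using assms(4) by (auto simp: bruhat_less_def bruhat_le_def)
qed

locale involution_group = group W
  for W :: "('w, 'm) monoid_scheme" (structure) +
  fixes S :: "'w set"
  assumes S_closed: "s \<in> S \<Longrightarrow> s \<in> carrier W"
    and S_square: "s \<in> S \<Longrightarrow> s \<otimes> s = \<one>"
    and generate_S: "generate W S = carrier W"
begin

abbreviation len :: "'w \<Rightarrow> nat" where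
  "len \<equiv> word_length W S"

abbreviation word_product :: "'w list \<Rightarrow> 'w" where
  "word_product ws \<equiv> foldr (\<otimes>) ws \<one>"

lemma S_inv: "s \<in> S \<Longrightarrow> inv s = s"
  using S_closed S_square by (intro inv_equality) auto

lemma S_cancel: "s \<in> S \<Longrightarrow> w \<in> carrier W \<Longrightarrow> s \<otimes> (s \<otimes> w) = w"
  using S_closed S_square by (simp flip: m_assoc)

lemma word_product_closed: "set ws \<subseteq> S \<Longrightarrow> word_product ws \<in> carrier W"
  using S_closed by (induction ws) auto

lemma word_product_append:
  assumes "set xs \<subseteq> S" "set ys \<subseteq> S"
  shows "word_product (xs @ ys) = word_product xs \<otimes> word_product ys"
  using assms(1)
proof (induction xs)
  case Nil
  then show ?case
    using word_product_closed[OF assms(2)] by simp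
next
  case (Cons s xs)
  then show ?case
    using S_closed word_product_closed[of xs] word_product_closed[OF assms(2)]
    by (simp add: m_assoc)
qed

lemma word_exists:
  assumes "w \<in> carrier W"
  shows "\<exists>ws. set ws \<subseteq> S \<and> word_product ws = w"
proof -
  have singleton: "\<exists>ws. set ws \<subseteq> S \<and> word_product ws = s" if "s \<in> S" for s
    using that S_closed by (intro exI[of _ "[s]"]) simp
  have "w \<in> generate W S"
    using assms generate_S by simp
  then show ?thesis
  proof (induction rule: generate.induct)
    case one
    show ?case
      by (intro exI[of _ "[]"]) simp
  next
    case (incl s)
    then show ?case
      by (rule singleton)
  next
    case (inv s)
    then show ?case
      using singleton S_inv by simp
  next
    case (eng x y)
    then obtain xs ys where "set xs \<subseteq> S" "word_product xs = x" "set ys \<subseteq> S" "word_product ys = y"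
      by blast
    then show ?case
      by (intro exI[of _ "xs @ ys"]) (simp only: word_product_append set_append Un_least simp_thms)
  qed
qed

lemma reduced_word_exists:
  assumes "w \<in> carrier W"
  shows "\<exists>ws. set ws \<subseteq> S \<and> length ws = len w \<and> word_product ws = w"
proof -
  have "\<exists>n ws. set ws \<subseteq> S \<and> length ws = n \<and> word_product ws = w"
    using word_exists[OF assms] by blast
  then show ?thesis
    unfolding word_length_def by (rule LeastI_ex)
qed

lemma len_word_product_le: "set ws \<subseteq> S \<Longrightarrow> len (word_product ws) \<le> length ws"
  unfolding word_length_def by (rule Least_le) blast

lemma len_one [simp]: "len \<one> = 0"
  using len_word_product_le[of "[]"] by simp

lemma len_eq_0_iff:
  assumes "w \<in> carrier W"
  shows "len w = 0 \<longleftrightarrow> w = \<one>"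
  using reduced_word_exists[OF assms] by auto

lemma len_mult_le:
  assumes "s \<in> S" "w \<in> carrier W"
  shows "len (s \<otimes> w) \<le> Suc (len w)"
proof -
  obtain ws where "set ws \<subseteq> S" "length ws = len w" "word_product ws = w"
    using reduced_word_exists[OF assms(2)] by blast
  then show ?thesis
    using len_word_product_le[of "s # ws"] assms(1) by simp
qed

lemma len_le_Suc_mult:
  assumes "s \<in> S" "w \<in> carrier W"
  shows "len w \<le> Suc (len (s \<otimes> w))"
  using len_mult_le[OF assms(1), of "s \<otimes> w"] S_cancel[OF assms] S_closed[OF assms(1)] assms(2)
  by simp

lemma len_Suc_obtain:
  assumes "w \<in> carrier W" "len w = Suc n"
  obtains s u where "s \<in> S" "u \<in> carrier W" "w = s \<otimes> u" "len u = n"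
proof -
  obtain ws where ws: "set ws \<subseteq> S" "length ws = Suc n" "word_product ws = w"
    using reduced_word_exists[OF assms(1)] assms(2) by auto
  then obtain s us where us: "ws = s # us"
    by (metis length_Suc_conv)
  let ?u = "word_product us"
  have s: "s \<in> S" and u: "?u \<in> carrier W" and w: "w = s \<otimes> ?u"
    using ws us word_product_closed[of us] by auto
  have "len ?u \<le> n"
    using len_word_product_le[of us] ws us by simp
  moreover have "Suc n \<le> Suc (len ?u)"
    using len_mult_le[OF s u] assms(2) w by simp
  ultimately show thesis
    using that s u w by simp
qed

end

text \<open>Coxeter groups have this property, as their length modulo 2 is a homomorphism.\<close>

locale bipartite_group = involution_group +
  assumes len_mult_neq: "s \<in> S \<Longrightarrow> w \<in> carrier W \<Longrightarrow> len (s \<otimes> w) \<noteq> len w"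

section \<open>Laurent polynomials\<close>

definition bar :: "laurent \<Rightarrow> laurent" where
  "bar = Poly_Mapping.map_key uminus"

lemma lookup_bar: "Poly_Mapping.lookup (bar p) n = Poly_Mapping.lookup p (- n)"
  unfolding bar_def by (simp add: Poly_Mapping.map_key.rep_eq)

lemma bar_zero: "bar 0 = 0"
  by (rule poly_mapping_eqI) (simp add: lookup_bar)

lemma bar_diff: "bar (p - q) = bar p - bar q"
  by (rule poly_mapping_eqI) (simp add: lookup_bar lookup_minus)

lemma bar_single: "bar (Poly_Mapping.single n a) = Poly_Mapping.single (- n) a"
  by (rule poly_mapping_eqI) (auto simp: lookup_bar lookup_single when_def)

lemma bar_v_inv: "bar v_inv = v"
  by (simp add: v_inv_def v_def bar_single)

lemma v_mult_v_inv: "v * v_inv = 1"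
  by (simp add: v_def v_inv_def mult_single)

lemma v_inv_mult_v: "v_inv * v = 1"
  using v_mult_v_inv by (simp add: mult.commute)

lemma negative_laurent_iff:
  "p \<in> negative_laurent \<longleftrightarrow> (\<forall>n\<ge>0. Poly_Mapping.lookup p n = 0)"
  unfolding negative_laurent_def by (auto simp: in_keys_iff subset_iff not_less[symmetric])

lemma negative_laurent_zero: "0 \<in> negative_laurent"
  by (simp add: negative_laurent_iff)

lemma negative_laurent_add:
  "p \<in> negative_laurent \<Longrightarrow> q \<in> negative_laurent \<Longrightarrow> p + q \<in> negative_laurent"
  by (simp add: negative_laurent_iff lookup_add)

lemma negative_laurent_diff:
  "p \<in> negative_laurent \<Longrightarrow> q \<in> negative_laurent \<Longrightarrow> p - q \<in> negative_laurent"
  by (simp add: negative_laurent_iff lookup_minus)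

lemma negative_laurent_mult:
  assumes "p \<in> negative_laurent" "q \<in> negative_laurent"
  shows "p * q \<in> negative_laurent"
proof -
  have "a + b < 0" if "a \<in> Poly_Mapping.keys p" "b \<in> Poly_Mapping.keys q" for a b
    using that assms by (intro add_neg_neg) (auto simp: negative_laurent_def)
  then show ?thesis
    using keys_mult[of p q] by (auto simp: negative_laurent_def)
qed

lemma v_inv_negative_laurent: "v_inv \<in> negative_laurent"
  by (simp add: negative_laurent_iff v_inv_def lookup_single when_def)

lemma negative_laurent_bar_fixed_imp_zero:
  assumes "p \<in> negative_laurent" "bar p = p"
  shows "p = 0"
proof (rule poly_mapping_eqI)
  fix n
  have "Poly_Mapping.lookup p n = Poly_Mapping.lookup p (- n)"
    using lookup_bar[of p n] assms(2) by simp
  then show "Poly_Mapping.lookup p n = Poly_Mapping.lookup 0 n"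
    using assms(1) by (cases "n \<ge> 0") (auto simp: negative_laurent_iff)
qed

section \<open>Coefficients with respect to the standard basis\<close>

context hecke_algebra
begin

definition coef :: "'w \<Rightarrow> 'h \<Rightarrow> laurent" where
  "coef w h = representation (t ` carrier W) h (t w)"

lemma coef_zero: "coef w 0 = 0"
  unfolding coef_def by (simp add: representation_zero)

lemma coef_add: "coef w (g + h) = coef w g + coef w h"
  unfolding coef_def by (simp add: representation_add basis_independent basis_span)

lemma coef_diff: "coef w (g - h) = coef w g - coef w h"
  unfolding coef_def by (simp add: representation_diff basis_independent basis_span)

lemma coef_scale: "coef w (a *s h) = a * coef w h"
  unfolding coef_def by (simp add: representation_scale basis_independent basis_span)

lemma coef_sum: "coef w (sum f A) = (\<Sum>x\<in>A. coef w (f x))"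
  by (induction A rule: infinite_finite_induct) (simp_all add: coef_zero coef_add)

lemma coef_basis:
  assumes "u \<in> carrier W" "w \<in> carrier W"
  shows "coef u (t w) = (if u = w then 1 else 0)"
  using assms inj_onD[OF basis_inj, of u w] unfolding coef_def
  by (auto simp: representation_basis[OF basis_independent])

lemma basis_induct [case_names zero step]:
  assumes "P 0" and "\<And>a w g. w \<in> carrier W \<Longrightarrow> P g \<Longrightarrow> P (a *s t w + g)"
  shows "P h"
proof -
  have "h \<in> span (t ` carrier W)"
    by (simp add: basis_span)
  then show ?thesis
    by (induction rule: span_induct_alt) (use assms in auto)
qed

definition support :: "'h \<Rightarrow> 'w set" where
  "support h = {w \<in> carrier W. coef w h \<noteq> 0}"

lemma basis_support_eq: "t ` support h = {b. representation (t ` carrier W) h b \<noteq> 0}"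
  using representation_ne_zero[of "t ` carrier W" h] by (auto simp: support_def coef_def)

lemma support_inj: "inj_on t (support h)"
  using basis_inj by (rule inj_on_subset) (auto simp: support_def)

lemma finite_support: "finite (support h)"
  using finite_representation[of "t ` carrier W" h] finite_imageD[OF _ support_inj]
  by (simp flip: basis_support_eq)

lemma sum_support: "(\<Sum>w\<in>support h. coef w h *s t w) = h"
proof -
  have "(\<Sum>b\<in>t ` support h. representation (t ` carrier W) h b *s b) = h"
    unfolding basis_support_eq
    by (rule sum_nonzero_representation_eq) (simp_all add: basis_independent basis_span)
  then show ?thesis
    by (simp add: sum.reindex[OF support_inj] coef_def)
qed

lemma eq_zero_if_support_empty: "support h = {} \<Longrightarrow> h = 0"
  using sum_support[of h] by simp

definition negative_span :: "'h set" where
  "negative_span = {h. \<forall>w\<in>carrier W. coef w h \<in> negative_laurent}"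

lemma negative_span_add:
  "g \<in> negative_span \<Longrightarrow> h \<in> negative_span \<Longrightarrow> g + h \<in> negative_span"
  by (simp add: negative_span_def coef_add negative_laurent_add)

lemma negative_span_diff:
  "g \<in> negative_span \<Longrightarrow> h \<in> negative_span \<Longrightarrow> g - h \<in> negative_span"
  by (simp add: negative_span_def coef_diff negative_laurent_diff)

lemma negative_span_scale:
  "a \<in> negative_laurent \<Longrightarrow> h \<in> negative_span \<Longrightarrow> a *s h \<in> negative_span"
  by (simp add: negative_span_def coef_scale negative_laurent_mult)

lemma negative_span_basis:
  "a \<in> negative_laurent \<Longrightarrow> w \<in> carrier W \<Longrightarrow> a *s t w \<in> negative_span"
  by (auto simp: negative_span_def coef_scale coef_basis negative_laurent_zero)

lemma negative_span_sum:
  "(\<And>x. x \<in> A \<Longrightarrow> f x \<in> negative_span) \<Longrightarrow> sum f A \<in> negative_span"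
  by (induction A rule: infinite_finite_induct)
     (auto simp: negative_span_add, auto simp: negative_span_def coef_zero negative_laurent_zero)

end

section \<open>The involution\<close>

context hecke_involution
begin

lemma \<iota>_zero: "\<iota> 0 = 0"
  using \<iota>_add[of 0 0] by simp

lemma \<iota>_diff: "\<iota> (g - h) = \<iota> g - \<iota> h"
  using \<iota>_add[of "g - h" h] by (simp add: algebra_simps)

lemma \<iota>_sum: "\<iota> (sum f A) = (\<Sum>x\<in>A. \<iota> (f x))"
  by (induction A rule: infinite_finite_induct) (simp_all add: \<iota>_zero \<iota>_add)

lemma \<iota>_v_power: "\<iota> (Poly_Mapping.single (int n) 1 *s 1) = Poly_Mapping.single (- int n) 1 *s 1"
proof (induction n)
  case 0
  then show ?case
    by (simp add: \<iota>_one)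
next
  case (Suc n)
  have "\<iota> (Poly_Mapping.single (int (Suc n)) 1 *s 1)
      = \<iota> ((v *s 1) * (Poly_Mapping.single (int n) 1 *s 1))"
    by (simp add: scale_mult_left v_def mult_single)
  also have "\<dots> = (v_inv *s 1) * (Poly_Mapping.single (- int n) 1 *s 1)"
    by (simp only: \<iota>_mult \<iota>_v Suc)
  also have "\<dots> = Poly_Mapping.single (- int (Suc n)) 1 *s 1"
    by (simp add: scale_mult_left v_inv_def mult_single)
  finally show ?case .
qed

lemma \<iota>_single: "\<iota> (Poly_Mapping.single n 1 *s 1) = Poly_Mapping.single (- n) 1 *s 1"
proof (cases n rule: int_cases2)
  case (nonneg j)
  then show ?thesis
    by (simp add: \<iota>_v_power)
next
  case (nonpos j)
  then show ?thesis
    using \<iota>_invol[of "Poly_Mapping.single (int j) 1 *s 1"] by (simp add: \<iota>_v_power)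
qed

lemma \<iota>_scale_one: "\<iota> (a *s 1) = bar a *s 1"
proof -
  have "Poly_Mapping.keys a \<subseteq> UNIV"
    by simp
  then show ?thesis
    by (induction a rule: frag_induction)
      (simp_all add: bar_zero \<iota>_zero \<iota>_single bar_single bar_diff scale_left_diff_distrib \<iota>_diff)
qed

lemma \<iota>_scale: "\<iota> (a *s h) = bar a *s \<iota> h"
proof -
  have scale_one_mult: "(b *s 1) * g = b *s g" for b g
    by (simp add: scale_mult_left)
  have "\<iota> (a *s h) = \<iota> (a *s 1) * \<iota> h"
    by (simp add: scale_one_mult flip: \<iota>_mult)
  then show ?thesis
    by (simp add: \<iota>_scale_one scale_one_mult)
qed

end

section \<open>Uniqueness of the Kazhdan-Lusztig basis\<close>

text \<open>For empty \<open>S\<close> the multiplication rules do not force \<open>t \<one> = 1\<close>.\<close>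

locale bipartite_hecke_involution =
  bipartite_group W S + hecke_involution scale W S t \<iota>
  for scale :: "laurent \<Rightarrow> 'h::ring_1 \<Rightarrow> 'h" (infixr \<open>*s\<close> 75)
    and W :: "('w, 'm) monoid_scheme" (structure)
    and S :: "'w set"
    and t :: "'w \<Rightarrow> 'h"
    and \<iota> :: "'h \<Rightarrow> 'h" +
  assumes S_nonempty: "S \<noteq> {}"
begin

lemma t_mult_longer:
  assumes "s \<in> S" "w \<in> carrier W" "len w < len (s \<otimes> w)"
  shows "t s * t w = t (s \<otimes> w)"
  using assms S_closed by (intro mult_up bruhat_less_left_mult)

lemma t_mult_shorter:
  assumes "s \<in> S" "w \<in> carrier W" "len (s \<otimes> w) < len w"
  shows "t s * t w = (v - v_inv) *s t w + t (s \<otimes> w)"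
proof -
  have "bruhat_less W S (s \<otimes> w) (s \<otimes> (s \<otimes> w))"
    using assms S_closed S_cancel by (intro bruhat_less_left_mult) auto
  then show ?thesis
    using assms S_cancel by (intro mult_down) auto
qed

lemma len_generator_pos: "s \<in> S \<Longrightarrow> 0 < len s"
  using len_mult_neq[of s \<one>] S_closed[of s] by simp

lemma t_one: "t \<one> = 1"
proof -
  obtain s where s: "s \<in> S"
    using S_nonempty by blast
  have "t s * t \<one> = t s"
    using t_mult_longer[OF s one_closed] len_generator_pos[OF s] S_closed[OF s] by simp
  then have "\<iota> (t s) * t s * t \<one> = \<iota> (t s) * t s"
    by (simp add: mult.assoc)
  then show ?thesis
    using \<iota>_basis[of s] S_closed[OF s] S_inv[OF s] by simp
qed

lemma t_generator_square:
  assumes "s \<in> S"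
  shows "t s * t s = (v - v_inv) *s t s + 1"
  using t_mult_shorter[OF assms, of s] len_generator_pos[OF assms] assms
  by (simp add: S_square S_closed t_one)

lemma \<iota>_t_generator:
  assumes "s \<in> S"
  shows "\<iota> (t s) = t s - (v - v_inv) *s 1"
proof -
  have inverse: "t s * (t s - (v - v_inv) *s 1) = 1"
    using t_generator_square[OF assms] by (simp add: right_diff_distrib scale_mult_right)
  have "\<iota> (t s) = \<iota> (t s) * (t s * (t s - (v - v_inv) *s 1))"
    by (simp only: inverse mult_1_right)
  also have "\<dots> = t s - (v - v_inv) *s 1"
    using \<iota>_basis[of s] S_closed[OF assms] S_inv[OF assms] by (simp flip: mult.assoc)
  finally show ?thesis .
qed

lemma coef_t_mult:
  assumes "s \<in> S" "u \<in> carrier W"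
  shows "coef u (t s * h) =
    coef (s \<otimes> u) h + (if len (s \<otimes> u) < len u then (v - v_inv) * coef u h else 0)"
proof (induction h rule: basis_induct)
  case zero
  then show ?case
    by (simp add: coef_zero)
next
  case (step a w g)
  have s: "s \<in> carrier W"
    using S_closed assms(1) by simp
  have transpose: "u = s \<otimes> w \<longleftrightarrow> s \<otimes> u = w"
    using S_cancel[OF assms(1)] assms(2) step(1) by auto
  have "coef u (t s * t w) =
      coef (s \<otimes> u) (t w) + (if len (s \<otimes> u) < len u then (v - v_inv) * coef u (t w) else 0)"
  proof (cases "len w < len (s \<otimes> w)")
    case True
    then show ?thesis
      using t_mult_longer[OF assms(1) step(1)] s assms(2) step(1) transpose by (auto simp: coef_basis)
  next
    case False
    then have "len (s \<otimes> w) < len w"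
      using len_mult_neq[OF assms(1) step(1)] by simp
    then show ?thesis
      using t_mult_shorter[OF assms(1) step(1)] s assms(2) step(1) transpose
      by (auto simp: coef_add coef_scale coef_basis)
  qed
  then show ?case
    using step by (simp add: distrib_left scale_mult_right coef_add coef_scale algebra_simps)
qed

lemma coef_\<iota>_t:
  assumes "w \<in> carrier W" "u \<in> carrier W" "len w \<le> len u"
  shows "coef u (\<iota> (t w)) = coef u (t w)"
  using assms
proof (induction "len w" arbitrary: w u)
  case 0
  then show ?case
    using len_eq_0_iff[of w] by (simp add: t_one \<iota>_one)
next
  case (Suc n)
  obtain s y where s: "s \<in> S" and y: "y \<in> carrier W" "w = s \<otimes> y" "len y = n"
    using len_Suc_obtain[of w n] Suc.prems(1) Suc.hyps(2) by metis
  have "u \<noteq> y" "n \<le> len (s \<otimes> u)"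
    using Suc.hyps(2) Suc.prems(3) y(3) len_le_Suc_mult[OF s Suc.prems(2)] by auto
  then have below: "coef u (\<iota> (t y)) = 0" "coef (s \<otimes> u) (\<iota> (t y)) = coef (s \<otimes> u) (t y)"
    using Suc.hyps(1)[of y] Suc.hyps(2) Suc.prems y s S_closed by (simp_all add: coef_basis)
  have "t w = t s * t y"
    using t_mult_longer[OF s y(1)] Suc.hyps(2) y by simp
  then have "\<iota> (t w) = (t s - (v - v_inv) *s 1) * \<iota> (t y)"
    by (simp add: \<iota>_mult \<iota>_t_generator[OF s])
  also have "\<dots> = t s * \<iota> (t y) - (v - v_inv) *s \<iota> (t y)"
    by (simp add: left_diff_distrib scale_mult_left)
  finally have "coef u (\<iota> (t w)) = coef (s \<otimes> u) (t y)"
    using below by (simp add: coef_diff coef_scale coef_t_mult[OF s Suc.prems(2)])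
  moreover have "s \<otimes> u = y \<longleftrightarrow> u = w"
    using y S_cancel[OF s] Suc.prems(2) by auto
  ultimately show ?case
    using Suc.prems s S_closed y(1) by (simp add: coef_basis)
qed

lemma coef_\<iota>_longest:
  assumes "u \<in> carrier W" "\<And>w. w \<in> support h \<Longrightarrow> len w \<le> len u"
  shows "coef u (\<iota> h) = bar (coef u h)"
proof -
  have carrier: "w \<in> carrier W" if "w \<in> support h" for w
    using that by (simp add: support_def)
  have "\<iota> h = \<iota> (\<Sum>w\<in>support h. coef w h *s t w)"
    by (simp only: sum_support)
  also have "\<dots> = (\<Sum>w\<in>support h. bar (coef w h) *s \<iota> (t w))"
    by (simp add: \<iota>_sum \<iota>_scale)
  finally have "coef u (\<iota> h) = (\<Sum>w\<in>support h. bar (coef w h) * coef u (\<iota> (t w)))"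
    by (simp add: coef_sum coef_scale)
  also have "\<dots> = (\<Sum>w\<in>support h. if u = w then bar (coef w h) else 0)"
    using assms carrier by (intro sum.cong) (simp_all add: coef_\<iota>_t coef_basis)
  also have "\<dots> = bar (coef u h)"
    using assms(1) by (simp add: finite_support) (simp add: support_def bar_zero)
  finally show ?thesis .
qed

lemma invariant_negative_span_imp_zero:
  assumes "\<iota> h = h" "h \<in> negative_span"
  shows "h = 0"
proof (rule ccontr)
  assume "h \<noteq> 0"
  then have "support h \<noteq> {}"
    using eq_zero_if_support_empty by blast
  then obtain u where u: "u \<in> support h" "\<And>w. w \<in> support h \<Longrightarrow> len w \<le> len u"
    using finite_support Max_in[of "len ` support h"] Max_ge[of "len ` support h"] by fastforce
  then have carrier: "u \<in> carrier W"
    by (simp add: support_def)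
  have "bar (coef u h) = coef u h"
    using coef_\<iota>_longest[of u h, OF carrier u(2)] assms(1) by simp
  then have "coef u h = 0"
    using negative_laurent_bar_fixed_imp_zero assms(2) carrier unfolding negative_span_def by blast
  then show False
    using u(1) by (simp add: support_def)
qed

end

locale bipartite_kazhdan_lusztig =
  bipartite_hecke_involution scale W S t \<iota> + kazhdan_lusztig_basis scale W S t \<iota> c
  for scale :: "laurent \<Rightarrow> 'h::ring_1 \<Rightarrow> 'h" (infixr \<open>*s\<close> 75)
    and W :: "('w, 'm) monoid_scheme" (structure)
    and S :: "'w set"
    and t :: "'w \<Rightarrow> 'h"
    and \<iota> :: "'h \<Rightarrow> 'h"
    and c :: "'w \<Rightarrow> 'h"
begin

lemma c_minus_t_negative_span:
  assumes "w \<in> carrier W"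
  shows "c w - t w \<in> negative_span"
proof -
  obtain p where "\<And>x. p x \<in> negative_laurent"
    "c w = t w + (\<Sum>x\<in>{x \<in> carrier W. bruhat_less W S x w}. p x *s t x)"
    using c_unitriangular[OF assms] by blast
  then show ?thesis
    by (auto intro!: negative_span_sum negative_span_basis)
qed

lemma c_eqI:
  assumes "w \<in> carrier W" "\<iota> h = h" "h - t w \<in> negative_span"
  shows "c w = h"
proof -
  have "c w - h = (c w - t w) - (h - t w)"
    by simp
  also have "\<dots> \<in> negative_span"
    using c_minus_t_negative_span[OF assms(1)] assms(3) by (rule negative_span_diff)
  finally have "c w - h = 0"
    using assms(1,2) by (intro invariant_negative_span_imp_zero) (simp_all add: \<iota>_diff c_invariant)
  then show ?thesis
    by simp
qed

lemma c_generator: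
  assumes "s \<in> S"
  shows "c s = t s + v_inv *s 1"
proof (rule c_eqI)
  show "\<iota> (t s + v_inv *s 1) = t s + v_inv *s 1"
    by (simp add: \<iota>_add \<iota>_t_generator[OF assms] \<iota>_scale bar_v_inv \<iota>_one scale_left_diff_distrib)
  show "t s + v_inv *s 1 - t s \<in> negative_span"
    using negative_span_basis[OF v_inv_negative_laurent one_closed] by (simp add: t_one)
qed (use assms S_closed in simp)

lemma c_generator_mult_longer:
  assumes "s \<in> S" "w \<in> carrier W" "len w < len (s \<otimes> w)"
  shows "c s * t w = t (s \<otimes> w) + v_inv *s t w"
  using t_mult_longer[OF assms]
  by (simp add: c_generator[OF assms(1)] distrib_right scale_mult_left)

lemma c_generator_square:
  assumes "s \<in> S"
  shows "c s * c s = (v + v_inv) *s c s"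
proof -
  have "c s * c s = t s * t s + v_inv *s t s + v_inv *s c s"
    by (simp add: c_generator[OF assms] distrib_left distrib_right scale_mult_left scale_mult_right
        algebra_simps)
  also have "\<dots> = v *s t s + (v * v_inv) *s 1 + v_inv *s c s"
    by (simp add: t_generator_square[OF assms] scale_left_diff_distrib v_mult_v_inv)
  also have "v *s t s + (v * v_inv) *s 1 = v *s c s"
    by (simp add: c_generator[OF assms] scale_right_distrib)
  finally show ?thesis
    by (simp add: scale_left_distrib)
qed

end

section \<open>The infinite dihedral group\<close>

definition letter :: "'a \<Rightarrow> 'a \<Rightarrow> int \<Rightarrow> 'a" where
  "letter a b n = (if even n then a else b)"

lemma letter_swap: "letter b a n = letter a b (n + 1)"
  by (simp add: letter_def)

lemma letter_cong: "even (m + n) \<Longrightarrow> letter a b m = letter a b n"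
  by (simp add: letter_def)

lemma letter_in: "letter a b n \<in> {a, b}"
  by (simp add: letter_def)

lemma (in group) alt_closed: "a \<in> carrier G \<Longrightarrow> b \<in> carrier G \<Longrightarrow> alt G j a b \<in> carrier G"
  by (induction j arbitrary: a b) auto

lemma (in group) alt_Suc_left:
  assumes "a \<in> carrier G" "b \<in> carrier G"
  shows "alt G (Suc j) a b = letter a b (int (Suc j)) \<otimes> alt G j a b"
  using assms
proof (induction j arbitrary: a b)
  case 0
  then show ?case
    by (simp add: letter_def)
next
  case (Suc j)
  have "letter b a (int (Suc j)) \<in> carrier G"
    using Suc.prems by (simp add: letter_def)
  then have "alt G (Suc (Suc j)) a b = letter b a (int (Suc j)) \<otimes> alt G (Suc j) a b"
    using Suc alt_closed by (simp add: m_assoc)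
  then show ?case
    by (simp add: letter_def)
qed

sublocale infinite_dihedral \<subseteq> involution_group W "{s1, s2}"
  using s1_closed s2_closed s1_order s2_order generated by unfold_locales auto

context infinite_dihedral
begin

text \<open>Left multiplication by generators walks along the vertices \<open>\<dots>, s1, \<one>, s2, s1 s2, \<dots>\<close> of
  this bi-infinite path.\<close>

definition vertex :: "int \<Rightarrow> 'w" where
  "vertex n = (if even n then \<one> else s2) \<otimes> (s1 \<otimes> s2) [^] (n div 2)"

lemma vertex_closed: "vertex n \<in> carrier W"
  using s1_closed s2_closed by (simp add: vertex_def)

lemma vertex_zero [simp]: "vertex 0 = \<one>"
  by (simp add: vertex_def)

lemma vertex_step_up: "letter s1 s2 (n + 1) \<otimes> vertex n = vertex (n + 1)"
proof (cases "even n")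
  case True
  then show ?thesis
    using s1_closed s2_closed by (simp add: vertex_def letter_def)
next
  case False
  then have "(s1 \<otimes> s2) [^] ((n + 1) div 2) = (s1 \<otimes> s2) \<otimes> (s1 \<otimes> s2) [^] (n div 2)"
    using s1_closed s2_closed int_pow_mult[of "s1 \<otimes> s2" 1 "n div 2"]
    by (auto elim!: oddE simp: add.commute)
  then show ?thesis
    using False s1_closed s2_closed by (simp add: vertex_def letter_def m_assoc)
qed

lemma vertex_step_down: "letter s1 s2 n \<otimes> vertex n = vertex (n - 1)"
  using vertex_step_up[of "n - 1"] S_cancel[OF letter_in vertex_closed, of n "n - 1"]
  by simp

lemma rotation_pow_eq_iff: "(s1 \<otimes> s2) [^] (m :: int) = (s1 \<otimes> s2) [^] n \<longleftrightarrow> m = n"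
proof -
  have "ord (s1 \<otimes> s2) = 0"
    using infinite_order s1_closed s2_closed by (simp add: ord_eq_0)
  then show ?thesis
    using s1_closed s2_closed by (auto simp: int_pow_eq)
qed

lemma s2_neq_rotation_pow: "s2 \<noteq> (s1 \<otimes> s2) [^] (n :: int)"
proof
  assume s2: "s2 = (s1 \<otimes> s2) [^] n"
  then have "(s1 \<otimes> s2) [^] (n + n) = (s1 \<otimes> s2) [^] (0 :: int)"
    using s2_order(2) s1_closed s2_closed int_pow_mult[of "s1 \<otimes> s2" n n] by simp
  then have "n = 0"
    using rotation_pow_eq_iff[of "n + n" 0] by simp
  then show False
    using s2 s2_order(1) by simp
qed

lemma vertex_odd_neq_even:
  assumes "odd m" "even n"
  shows "vertex m \<noteq> vertex n"
proof
  let ?r = "s1 \<otimes> s2"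
  assume "vertex m = vertex n"
  then have "s2 \<otimes> ?r [^] (m div 2) = ?r [^] (n div 2)"
    using assms s1_closed s2_closed by (simp add: vertex_def)
  then have "s2 = ?r [^] (n div 2) \<otimes> inv (?r [^] (m div 2))"
    using s1_closed s2_closed by (simp add: inv_solve_right)
  then show False
    using s2_neq_rotation_pow[of "n div 2 - m div 2"] s1_closed s2_closed
    by (simp add: int_pow_diff)
qed

lemma vertex_inj: "vertex m = vertex n \<longleftrightarrow> m = n"
proof
  assume eq: "vertex m = vertex n"
  then have parity: "even m \<longleftrightarrow> even n"
    using vertex_odd_neq_even by metis
  then have "m div 2 = n div 2"
    using eq s1_closed s2_closed
    by (auto simp: vertex_def rotation_pow_eq_iff split: if_splits)
  then show "m = n"
    using parity by presburger
qed simp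

lemma generator_mult_vertex:
  assumes "s \<in> {s1, s2}"
  obtains "s \<otimes> vertex n = vertex (n + 1)" | "s \<otimes> vertex n = vertex (n - 1)"
  using vertex_step_up[of n] vertex_step_down[of n] assms that
  by (auto simp: letter_def split: if_splits)

lemma word_product_eq_vertex:
  "set ws \<subseteq> {s1, s2} \<Longrightarrow> \<exists>n. \<bar>n\<bar> \<le> int (length ws) \<and> word_product ws = vertex n"
proof (induction ws)
  case Nil
  show ?case
    by (intro exI[of _ 0]) simp
next
  case (Cons s ws)
  then obtain n where n: "\<bar>n\<bar> \<le> int (length ws)" "word_product ws = vertex n"
    by auto
  have "s \<in> {s1, s2}"
    using Cons.prems by simp
  then show ?case
  proof (cases rule: generator_mult_vertex[of s n])
    case 1
    then show ?thesis
      using n by (intro exI[of _ "n + 1"]) simp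
  next
    case 2
    then show ?thesis
      using n by (intro exI[of _ "n - 1"]) simp
  qed
qed

lemma alt_eq_vertex: "alt W j s1 s2 = vertex (int j)" "alt W j s2 s1 = vertex (- int j)"
proof (induction j)
  case (Suc j)
  have "letter s2 s1 (int (Suc j)) = letter s1 s2 (- int j)" "- int (Suc j) = - int j - 1"
    by (simp_all add: letter_def)
  then show "alt W (Suc j) s2 s1 = vertex (- int (Suc j))"
    using Suc.IH(2) alt_Suc_left[OF s2_closed s1_closed] vertex_step_down[of "- int j"]
    by (simp only:)
  show "alt W (Suc j) s1 s2 = vertex (int (Suc j))"
    using Suc.IH(1) alt_Suc_left[OF s1_closed s2_closed] vertex_step_up[of "int j"]
    by (simp add: add.commute del: alt.simps)
qed simp_all

abbreviation generator_pair :: "'w \<Rightarrow> 'w \<Rightarrow> bool" where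
  "generator_pair a b \<equiv> (a, b) \<in> {(s1, s2), (s2, s1)}"

lemma generator_pair_swap: "generator_pair a b \<Longrightarrow> generator_pair b a"
  by auto

lemma generator_pair_closed:
  assumes "generator_pair a b"
  shows "a \<in> carrier W" "b \<in> carrier W"
  using assms s1_closed s2_closed by auto

lemma generator_pair_alt_closed: "generator_pair a b \<Longrightarrow> alt W j a b \<in> carrier W"
  by (intro alt_closed generator_pair_closed[of a b])

lemma len_alt_le: "generator_pair a b \<Longrightarrow> len (alt W j a b) \<le> j"
proof (induction j arbitrary: a b)
  case (Suc j)
  let ?s = "letter a b (int (Suc j))"
  have "?s \<in> {s1, s2}"
    using Suc.prems letter_in[of a b "int (Suc j)"] by auto
  then have "len (?s \<otimes> alt W j a b) \<le> Suc (len (alt W j a b))"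
    using generator_pair_alt_closed[OF Suc.prems] by (rule len_mult_le)
  then show ?case
    using Suc.IH[OF Suc.prems]
    unfolding alt_Suc_left[OF generator_pair_closed[OF Suc.prems]] by linarith
qed simp

lemma len_vertex: "len (vertex n) = nat \<bar>n\<bar>"
proof (rule antisym)
  show "len (vertex n) \<le> nat \<bar>n\<bar>"
    using len_alt_le[of s1 s2 "nat n"] len_alt_le[of s2 s1 "nat (- n)"]
    by (cases "n \<ge> 0") (simp_all add: alt_eq_vertex)
  obtain ws where ws: "set ws \<subseteq> {s1, s2}" "length ws = len (vertex n)" "word_product ws = vertex n"
    using reduced_word_exists[OF vertex_closed] by blast
  then show "nat \<bar>n\<bar> \<le> len (vertex n)"
    using word_product_eq_vertex[OF ws(1)] vertex_inj by auto
qed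

lemma len_alt: "generator_pair a b \<Longrightarrow> len (alt W j a b) = j"
  by (auto simp: alt_eq_vertex len_vertex)

end

sublocale infinite_dihedral \<subseteq> bipartite_group W "{s1, s2}"
proof
  fix s w
  assume s: "s \<in> {s1, s2}" and w: "w \<in> carrier W"
  obtain n where n: "w = vertex n"
    using word_exists[OF w] word_product_eq_vertex by metis
  from s show "len (s \<otimes> w) \<noteq> len w"
    by (cases rule: generator_mult_vertex[of s n]) (auto simp: n len_vertex)
qed

section \<open>The Kazhdan-Lusztig basis of the infinite dihedral group\<close>

locale dihedral_kazhdan_lusztig =
  infinite_dihedral W s1 s2 + kazhdan_lusztig_basis scale W "{s1, s2}" t \<iota> c
  for scale :: "laurent \<Rightarrow> 'h::ring_1 \<Rightarrow> 'h" (infixr \<open>*s\<close> 75)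
    and W :: "('w, 'm) monoid_scheme" (structure)
    and s1 s2 :: 'w
    and t :: "'w \<Rightarrow> 'h"
    and \<iota> :: "'h \<Rightarrow> 'h"
    and c :: "'w \<Rightarrow> 'h"

sublocale dihedral_kazhdan_lusztig \<subseteq> bipartite_kazhdan_lusztig scale W "{s1, s2}" t \<iota> c
  by unfold_locales simp

context dihedral_kazhdan_lusztig
begin

text \<open>\<open>ball n\<close> is the sum of $v^{l(w) - n} t_w$ over all \<open>w\<close> of length at most \<open>n\<close>.\<close>

primrec ball :: "nat \<Rightarrow> 'h" where
  "ball 0 = 1"
| "ball (Suc n) = t (alt W (Suc n) s1 s2) + t (alt W (Suc n) s2 s1) + v_inv *s ball n"

text \<open>For $n > 0$ this is $c_{\langle n, a, b]}$; the value 0 instead of $c_1 = 1$ at $n = 0$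
  makes the multiplication rules hold without exception.\<close>

primrec kl :: "'w \<Rightarrow> 'w \<Rightarrow> nat \<Rightarrow> 'h" where
  "kl a b 0 = 0"
| "kl a b (Suc n) = t (alt W (Suc n) a b) + v_inv *s ball n"

lemma generator_pair_letter:
  "generator_pair a b \<Longrightarrow> generator_pair (letter a b n) (letter a b (n + 1))"
  by (auto simp: letter_def)

lemma letter_generator: "generator_pair a b \<Longrightarrow> letter a b n \<in> {s1, s2}"
  using letter_in[of a b n] by auto

lemma c_letter_mult_t_alt:
  assumes "generator_pair a b"
  shows "c (letter a b (int (Suc n))) * t (alt W n a b) =
    t (alt W (Suc n) a b) + v_inv *s t (alt W n a b)"
proof -
  have "letter a b (int (Suc n)) \<otimes> alt W n a b = alt W (Suc n) a b"
    using alt_Suc_left[OF generator_pair_closed[OF assms]] by simp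
  then show ?thesis
    using c_generator_mult_longer[OF letter_generator generator_pair_alt_closed, OF assms assms]
      len_alt[OF assms]
    by (metis lessI)
qed

lemma ball_eq_t_plus_kl:
  assumes "generator_pair a b"
  shows "ball n = t (alt W n a b) + kl b a n"
  using assms by (cases n) (auto simp: t_one add_ac simp del: alt.simps(2))

lemma kl_Suc_eq:
  assumes "generator_pair a b"
  shows "kl a b (Suc n) = c (letter a b (int (Suc n))) * t (alt W n a b) + v_inv *s kl b a n"
  by (simp add: c_letter_mult_t_alt[OF assms] ball_eq_t_plus_kl[OF assms] scale_right_distrib
      add.assoc del: alt.simps of_nat_Suc)

lemma c_letter_mult_kl_same:
  assumes "generator_pair a b"
  shows "c (letter a b (int n)) * kl a b n = (v + v_inv) *s kl a b n"
  using assms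
proof (induction n arbitrary: a b)
  case (Suc n)
  let ?s = "letter a b (int (Suc n))"
  have "?s = letter b a (int n)"
    by (simp add: letter_def)
  then have "c ?s * kl b a n = (v + v_inv) *s kl b a n"
    using Suc.IH[OF generator_pair_swap[OF Suc.prems]] by simp
  moreover have "c ?s * (c ?s * h) = (v + v_inv) *s (c ?s * h)" for h
    by (simp add: c_generator_square[OF letter_generator[OF Suc.prems]] scale_mult_left
        flip: mult.assoc)
  ultimately show ?case
    unfolding kl_Suc_eq[OF Suc.prems]
    by (simp only: distrib_left scale_mult_right scale_right_distrib scale_left_commute[of v_inv])
qed simp

lemma c_letter_mult_kl_next:
  assumes "generator_pair a b"
  shows "c (letter a b (int n)) * kl a b (Suc n) = kl a b n + kl a b (Suc (Suc n))"
proof -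
  let ?s = "letter a b (int n)"
  note swapped = generator_pair_swap[OF assms]
  have letters: "?s = letter a b (int (Suc (Suc n)))" "?s = letter b a (int (Suc n))"
    by (simp_all add: letter_def)
  have top_term: "c ?s * t (alt W (Suc n) a b) =
      t (alt W (Suc (Suc n)) a b) + v_inv *s t (alt W (Suc n) a b)"
    using c_letter_mult_t_alt[OF assms, of "Suc n"] by (simp only: letters(1))
  have "v_inv *s (c ?s * kl a b n) = kl a b n + v_inv *s (v_inv *s kl a b n)"
    by (simp add: c_letter_mult_kl_same[OF assms] scale_left_distrib scale_right_distrib v_inv_mult_v)
  then have lower_terms: "v_inv *s (c ?s * ball n) = kl a b n + v_inv *s kl b a (Suc n)"
    using c_letter_mult_t_alt[OF swapped, of n] ball_eq_t_plus_kl[OF swapped, of n]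
    by (simp add: letters(2) distrib_left scale_right_distrib add_ac del: alt.simps of_nat_Suc)
  show ?thesis
    unfolding kl.simps(2)[of a b n] kl.simps(2)[of a b "Suc n"]
    by (simp only: distrib_left scale_mult_right top_term lower_terms
        ball_eq_t_plus_kl[OF assms, of "Suc n"] scale_right_distrib add_ac)
qed

lemma kl_one: "generator_pair a b \<Longrightarrow> kl a b 1 = c b"
  using generator_pair_closed[of a b] by (auto simp: c_generator)

lemma \<iota>_kl:
  assumes "generator_pair a b"
  shows "\<iota> (kl a b n) = kl a b n"
proof (induction n rule: induct_nat_012)
  case 0
  show ?case
    by (simp add: \<iota>_zero)
next
  case 1
  show ?case
    using kl_one[OF assms] c_invariant[of b] generator_pair_closed[OF assms] by simp
next
  case (ge2 n)
  let ?s = "letter a b (int n)"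
  have "\<iota> (c ?s) = c ?s"
    using letter_generator[OF assms] S_closed by (intro c_invariant) blast
  moreover have "kl a b (Suc (Suc n)) = c ?s * kl a b (Suc n) - kl a b n"
    using c_letter_mult_kl_next[OF assms, of n] by simp
  ultimately show ?case
    using ge2 by (simp only: \<iota>_diff \<iota>_mult)
qed

lemma v_inv_ball_negative_span: "v_inv *s ball n \<in> negative_span"
proof (induction n)
  case 0
  then show ?case
    using negative_span_basis[OF v_inv_negative_laurent one_closed] by (simp add: t_one)
next
  case (Suc n)
  have "v_inv *s t (alt W (Suc n) a b) \<in> negative_span" if "generator_pair a b" for a b
    using generator_pair_alt_closed[OF that] by (intro negative_span_basis v_inv_negative_laurent)
  then show ?case
    using negative_span_scale[OF v_inv_negative_laurent Suc]
    by (simp add: scale_right_distrib negative_span_add del: alt.simps scale_scale)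
qed

lemma c_alt_eq_kl:
  assumes "generator_pair a b" "n > 0"
  shows "c (alt W n a b) = kl a b n"
proof -
  obtain m where n: "n = Suc m"
    using assms(2) gr0_implies_Suc by blast
  show ?thesis
    unfolding n using assms(1) v_inv_ball_negative_span[of m]
    by (intro c_eqI generator_pair_alt_closed \<iota>_kl) (simp_all del: alt.simps)
qed

section \<open>Sums over centred intervals\<close>

definition centred_sum :: "(int \<Rightarrow> 'a::comm_monoid_add) \<Rightarrow> int \<Rightarrow> nat \<Rightarrow> 'a" where
  "centred_sum f k n = (\<Sum>m<n. f (k - int n + 1 + 2 * int m))"

lemma centred_sum_Suc_lower:
  "centred_sum f k (Suc n) = f (k - int n) + centred_sum f (k + 1) n"
  unfolding centred_sum_def by (subst sum.lessThan_Suc_shift) (simp add: algebra_simps)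

lemma centred_sum_neighbours:
  "centred_sum (\<lambda>m. f (m - 1) + f (m + 1)) k (Suc n) =
    centred_sum f k n + centred_sum f k (Suc (Suc n))"
proof -
  have "centred_sum (\<lambda>m. f (m - 1) + f (m + 1)) k (Suc n) =
      centred_sum f (k - 1) (Suc n) + centred_sum f (k + 1) (Suc n)"
    unfolding centred_sum_def by (simp add: sum.distrib algebra_simps)
  also have "centred_sum f (k - 1) (Suc n) = f (k - int (Suc n)) + centred_sum f k n"
    using centred_sum_Suc_lower[of f "k - 1" n] by (simp add: algebra_simps)
  also have "\<dots> + centred_sum f (k + 1) (Suc n) =
      centred_sum f k n + centred_sum f k (Suc (Suc n))"
    by (simp add: centred_sum_Suc_lower[of f k "Suc n"] add_ac)
  finally show ?thesis .
qed

lemma centred_sum_commute: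
  fixes f :: "int \<Rightarrow> 'a::ab_group_add"
  assumes odd: "\<And>n. f (- n) = - f n" and zero: "f 0 = 0"
  shows "centred_sum f (int k) n = centred_sum f (int n) k"
proof -
  have shifted: "centred_sum f (int j) (j + d) = centred_sum f (int (j + d)) j" for j d
  proof (induction d arbitrary: j rule: induct_nat_012)
    case 1
    then show ?case
      using centred_sum_Suc_lower[of f "int j" j] by (simp add: zero add.commute)
  next
    case (ge2 d)
    have "centred_sum f (int j) (j + Suc (Suc d)) =
        f (- int (Suc d)) + centred_sum f (int (Suc j)) (Suc j + d)"
      using centred_sum_Suc_lower[of f "int j" "Suc j + d"] by (simp add: algebra_simps)
    also have "\<dots> = - f (int (Suc d)) + centred_sum f (int (Suc j + d)) (Suc j)"
      by (simp only: odd ge2.IH(1))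
    also have "\<dots> = centred_sum f (int (j + Suc (Suc d))) j"
      using centred_sum_Suc_lower[of f "int (Suc j + d)" j] by (simp add: algebra_simps)
    finally show ?case .
  qed simp
  show ?thesis
    using shifted[of k "n - k"] shifted[of n "k - n"] by (cases "k \<le> n") simp_all
qed

lemma centred_sum_eq_nat_sum:
  assumes "n \<le> k"
  shows "centred_sum f (int k) n = (\<Sum>m\<in>{0..<n}. f (int (k - n + 1 + 2 * m)))"
  unfolding centred_sum_def lessThan_atLeast0 using assms
  by (intro sum.cong) (simp_all add: of_nat_diff algebra_simps)

lemma sum_neighbours:
  fixes f :: "nat \<Rightarrow> 'a::ring_1"
  assumes "n > 0"
  shows "(\<Sum>m\<in>{0..<n}. f m + f (Suc m)) = f 0 + (\<Sum>m\<in>{1..<n}. 2 * f m) + f n"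
  using assms
proof (induction n rule: nat_induct_non_zero)
  case (Suc n)
  then show ?case
    by (simp add: mult_2 algebra_simps)
qed simp

lemma centred_sum_neighbours_eq_nat_sum:
  fixes f :: "int \<Rightarrow> 'a::ring_1"
  assumes "0 < n" "n \<le> k"
  shows "centred_sum (\<lambda>m. f (m - 1) + f (m + 1)) (int k) n =
    f (int (k - n)) + (\<Sum>m\<in>{1..<n}. 2 * f (int (k - n + 2 * m))) + f (int (k + n))"
proof -
  have "centred_sum (\<lambda>m. f (m - 1) + f (m + 1)) (int k) n =
      (\<Sum>m\<in>{0..<n}. f (int (k - n + 2 * m)) + f (int (k - n + 2 * Suc m)))"
    unfolding centred_sum_eq_nat_sum[OF assms(2)] by (simp add: algebra_simps)
  also have "\<dots> = f (int (k - n)) + (\<Sum>m\<in>{1..<n}. 2 * f (int (k - n + 2 * m)))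
      + f (int (k - n + 2 * n))"
    using sum_neighbours[OF assms(1), of "\<lambda>m. f (int (k - n + 2 * m))"] by simp
  also have "k - n + 2 * n = k + n"
    using assms(2) by simp
  finally show ?thesis .
qed

section \<open>Products of basis elements\<close>

definition odd_kl :: "'w \<Rightarrow> 'w \<Rightarrow> int \<Rightarrow> 'h" where
  "odd_kl a b n = (if n \<ge> 0 then kl a b (nat n) else - kl a b (nat (- n)))"

lemma odd_kl_of_nat: "odd_kl a b (int n) = kl a b n"
  by (simp add: odd_kl_def)

lemma odd_kl_minus: "odd_kl a b (- n) = - odd_kl a b n"
  by (simp add: odd_kl_def)

lemma odd_kl_zero: "odd_kl a b 0 = 0"
  by (simp add: odd_kl_def)

lemma c_letter_mult_odd_kl_next:
  assumes "generator_pair a b"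
  shows "c (letter a b (n + 1)) * odd_kl a b n = odd_kl a b (n - 1) + odd_kl a b (n + 1)"
proof -
  have nonneg_case: "c (letter a b (int m + 1)) * odd_kl a b (int m) =
      odd_kl a b (int m - 1) + odd_kl a b (int m + 1)" for m
  proof (cases m)
    case 0
    then show ?thesis
      using odd_kl_minus[of a b 1] by (simp add: odd_kl_zero)
  next
    case (Suc j)
    have "int m = int (Suc j)" "int m - 1 = int j" "int m + 1 = int (Suc (Suc j))"
      using Suc by simp_all
    moreover have "letter a b (int m + 1) = letter a b (int j)"
      using Suc by (intro letter_cong) simp
    ultimately show ?thesis
      using c_letter_mult_kl_next[OF assms, of j] by (simp only: odd_kl_of_nat)
  qed
  show ?thesis
  proof (cases n rule: int_cases2)
    case (nonneg m)
    then show ?thesis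
      using nonneg_case by simp
  next
    case (nonpos m)
    have "n - 1 = - (int m + 1)" "n + 1 = - (int m - 1)"
      using nonpos by simp_all
    moreover have "letter a b (n + 1) = letter a b (int m + 1)"
      using nonpos by (intro letter_cong) simp
    ultimately show ?thesis
      using nonneg_case[of m] nonpos by (simp only: odd_kl_minus) simp
  qed
qed

lemma kl_mult_eq_centred_sum:
  assumes "generator_pair a b"
    and recurrence: "\<And>n. c (letter a b (n + 1)) * L n = L (n - 1) + L (n + 1)"
    and start: "c (letter a b k) * h = L k"
  shows "kl (letter a b (k + 1)) (letter a b k) i * h = centred_sum L k i"
proof -
  let ?x = "letter a b (k + 1)" and ?y = "letter a b k"
  note pair = generator_pair_swap[OF generator_pair_letter[OF assms(1), of k]]
  have sum_recurrence: "c (letter ?x ?y (int i)) * centred_sum L k (Suc i) =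
      centred_sum L k i + centred_sum L k (Suc (Suc i))" for i
  proof -
    let ?s = "letter ?x ?y (int i)"
    have summand: "c ?s * L n = L (n - 1) + L (n + 1)" if "even (n + k + int i)" for n
    proof -
      have "?s = letter a b (n + 1)"
        using that by (auto simp: letter_def)
      then show ?thesis
        using recurrence by simp
    qed
    have "c ?s * centred_sum L k (Suc i) = centred_sum (\<lambda>n. L (n - 1) + L (n + 1)) k (Suc i)"
      unfolding centred_sum_def sum_distrib_left by (intro sum.cong refl summand) simp
    then show ?thesis
      by (simp only: centred_sum_neighbours)
  qed
  show ?thesis
  proof (induction i rule: induct_nat_012)
    case 0
    show ?case
      by (simp add: centred_sum_def)
  next
    case 1
    show ?case
      using kl_one[OF pair] start by (simp add: centred_sum_def)
  next
    case (ge2 i)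
    have "kl ?x ?y (Suc (Suc i)) = c (letter ?x ?y (int i)) * kl ?x ?y (Suc i) - kl ?x ?y i"
      using c_letter_mult_kl_next[OF pair, of i] by simp
    then have "kl ?x ?y (Suc (Suc i)) * h =
        c (letter ?x ?y (int i)) * (kl ?x ?y (Suc i) * h) - kl ?x ?y i * h"
      by (simp only: left_diff_distrib mult.assoc)
    then show ?case
      by (simp only: ge2 sum_recurrence) simp
  qed
qed

lemma kl_mult_same_letter:
  assumes "generator_pair a b"
  shows "kl (letter a b (int k + 1)) (letter a b (int k)) i * kl a b k =
    centred_sum (\<lambda>n. (v + v_inv) *s odd_kl a b n) (int k) i"
proof (rule kl_mult_eq_centred_sum[OF assms])
  show "c (letter a b (n + 1)) * ((v + v_inv) *s odd_kl a b n) =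
      (v + v_inv) *s odd_kl a b (n - 1) + (v + v_inv) *s odd_kl a b (n + 1)" for n
    by (simp only: scale_mult_right c_letter_mult_odd_kl_next[OF assms] scale_right_distrib)
  show "c (letter a b (int k)) * kl a b k = (v + v_inv) *s odd_kl a b (int k)"
    by (simp only: c_letter_mult_kl_same[OF assms] odd_kl_of_nat)
qed

lemma kl_mult_other_letter:
  assumes "generator_pair a b"
  shows "kl (letter a b (int k)) (letter a b (int k + 1)) i * kl a b k =
    centred_sum (\<lambda>n. odd_kl a b (n - 1) + odd_kl a b (n + 1)) (int k) i"
proof -
  let ?L = "\<lambda>n. odd_kl a b (n - 1) + odd_kl a b (n + 1)"
  have recurrence: "c (letter b a (n + 1)) * ?L n = ?L (n - 1) + ?L (n + 1)" for n
  proof -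
    have "letter b a (n + 1) = letter a b (n - 1 + 1)" "letter b a (n + 1) = letter a b (n + 1 + 1)"
      by (simp_all add: letter_def)
    then show ?thesis
      using c_letter_mult_odd_kl_next[OF assms, of "n - 1"]
        c_letter_mult_odd_kl_next[OF assms, of "n + 1"]
      by (simp only: distrib_left)
  qed
  have start: "c (letter b a (int k)) * kl a b k = ?L (int k)"
    using c_letter_mult_odd_kl_next[OF assms, of "int k"]
    by (simp only: letter_swap[of b a] odd_kl_of_nat)
  have "letter b a (int k + 1) = letter a b (int k)" "letter b a (int k) = letter a b (int k + 1)"
    by (simp_all add: letter_def)
  then show ?thesis
    using kl_mult_eq_centred_sum[OF generator_pair_swap[OF assms], of ?L, OF recurrence start]
    by simp
qed

lemma centred_sum_scale_odd_kl:
  assumes "generator_pair a b" "n \<le> j"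
  shows "centred_sum (\<lambda>m. p *s odd_kl a b m) (int j) n =
    (\<Sum>m\<in>{0..<n}. p *s c (alt W (j - n + 1 + 2 * m) a b))"
  by (simp only: centred_sum_eq_nat_sum[OF assms(2)] odd_kl_of_nat c_alt_eq_kl[OF assms(1)]
      add_gr_0 zero_less_one simp_thms)

lemma c_alt_mult_same_letter:
  fixes i k :: nat
  assumes "generator_pair a b" "0 < i" "0 < k"
  defines "x \<equiv> letter a b (int k)" and "y \<equiv> letter a b (int k + 1)"
  shows "i \<le> k \<Longrightarrow> c (alt W i y x) * c (alt W k a b) =
      (\<Sum>m\<in>{0..<i}. (v + v_inv) *s c (alt W (k - i + 1 + 2 * m) a b))"
    and "k \<le> i \<Longrightarrow> c (alt W i y x) * c (alt W k a b) =
      (\<Sum>m\<in>{0..<k}. (v + v_inv) *s c (alt W (i - k + 1 + 2 * m) a b))"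
proof -
  let ?L = "\<lambda>n. (v + v_inv) *s odd_kl a b n"
  have pair: "generator_pair y x"
    unfolding x_def y_def by (rule generator_pair_swap[OF generator_pair_letter[OF assms(1)]])
  have product: "c (alt W i y x) * c (alt W k a b) = centred_sum ?L (int k) i"
    using kl_mult_same_letter[OF assms(1), of k i] unfolding x_def[symmetric] y_def[symmetric]
    by (simp only: c_alt_eq_kl[OF pair assms(2)] c_alt_eq_kl[OF assms(1,3)])
  then show "i \<le> k \<Longrightarrow> c (alt W i y x) * c (alt W k a b) =
      (\<Sum>m\<in>{0..<i}. (v + v_inv) *s c (alt W (k - i + 1 + 2 * m) a b))"
    by (simp only: centred_sum_scale_odd_kl[OF assms(1)])
  have "centred_sum ?L (int k) i = centred_sum ?L (int i) k"
    by (rule centred_sum_commute) (simp_all add: odd_kl_minus odd_kl_zero)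
  then show "k \<le> i \<Longrightarrow> c (alt W i y x) * c (alt W k a b) =
      (\<Sum>m\<in>{0..<k}. (v + v_inv) *s c (alt W (i - k + 1 + 2 * m) a b))"
    by (simp only: product centred_sum_scale_odd_kl[OF assms(1)])
qed

lemma odd_kl_neighbours_minus:
  "odd_kl a b (- n - 1) + odd_kl a b (- n + 1) = - (odd_kl a b (n - 1) + odd_kl a b (n + 1))"
proof -
  have "- n - 1 = - (n + 1)" "- n + 1 = - (n - 1)"
    by simp_all
  then show ?thesis
    by (simp only: odd_kl_minus) simp
qed

lemma centred_sum_odd_kl_neighbours:
  assumes "generator_pair a b" "0 < n" "n \<le> j"
  shows "centred_sum (\<lambda>m. odd_kl a b (m - 1) + odd_kl a b (m + 1)) (int j) n =
    kl a b (j - n) + (\<Sum>m\<in>{1..<n}. 2 * c (alt W (j - n + 2 * m) a b)) + c (alt W (j + n) a b)"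
proof -
  have "2 * kl a b (j - n + 2 * m) = 2 * c (alt W (j - n + 2 * m) a b)" if "m \<in> {1..<n}" for m
    using that c_alt_eq_kl[OF assms(1), of "j - n + 2 * m"] by simp
  moreover have "kl a b (j + n) = c (alt W (j + n) a b)"
    using assms(2) c_alt_eq_kl[OF assms(1), of "j + n"] by simp
  ultimately show ?thesis
    using centred_sum_neighbours_eq_nat_sum[OF assms(2,3), of "odd_kl a b"]
    by (simp only: odd_kl_of_nat cong: sum.cong)
qed

lemma c_alt_mult_other_letter:
  fixes i k :: nat
  assumes "generator_pair a b" "0 < i" "0 < k"
  defines "x \<equiv> letter a b (int k)" and "y \<equiv> letter a b (int k + 1)"
  shows "i < k \<Longrightarrow> c (alt W i x y) * c (alt W k a b) = c (alt W (k - i) a b)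
      + (\<Sum>m\<in>{1..<i}. 2 * c (alt W (k - i + 2 * m) a b)) + c (alt W (k + i) a b)"
    and "i = k \<Longrightarrow> c (alt W i x y) * c (alt W k a b) =
      (\<Sum>m\<in>{1..<k}. 2 * c (alt W (2 * m) a b)) + c (alt W (2 * k) a b)"
    and "k < i \<Longrightarrow> c (alt W i x y) * c (alt W k a b) = c (alt W (i - k) a b)
      + (\<Sum>m\<in>{1..<k}. 2 * c (alt W (i - k + 2 * m) a b)) + c (alt W (i + k) a b)"
proof -
  let ?L = "\<lambda>n. odd_kl a b (n - 1) + odd_kl a b (n + 1)"
  have pair: "generator_pair x y"
    unfolding x_def y_def by (intro generator_pair_letter assms(1))
  have product: "c (alt W i x y) * c (alt W k a b) = centred_sum ?L (int k) i"
    using kl_mult_other_letter[OF assms(1), of k i] unfolding x_def[symmetric] y_def[symmetric]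
    by (simp only: c_alt_eq_kl[OF pair assms(2)] c_alt_eq_kl[OF assms(1,3)])
  have commute: "centred_sum ?L (int k) i = centred_sum ?L (int i) k"
    by (rule centred_sum_commute, rule odd_kl_neighbours_minus) (simp add: odd_kl_minus)
  show "i < k \<Longrightarrow> c (alt W i x y) * c (alt W k a b) = c (alt W (k - i) a b)
      + (\<Sum>m\<in>{1..<i}. 2 * c (alt W (k - i + 2 * m) a b)) + c (alt W (k + i) a b)"
    using product centred_sum_odd_kl_neighbours[OF assms(1,2), of k]
      c_alt_eq_kl[OF assms(1), of "k - i"]
    by simp
  show "i = k \<Longrightarrow> c (alt W i x y) * c (alt W k a b) =
      (\<Sum>m\<in>{1..<k}. 2 * c (alt W (2 * m) a b)) + c (alt W (2 * k) a b)"
    using product centred_sum_odd_kl_neighbours[OF assms(1,3), of k] by (simp flip: mult_2)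
  show "k < i \<Longrightarrow> c (alt W i x y) * c (alt W k a b) = c (alt W (i - k) a b)
      + (\<Sum>m\<in>{1..<k}. 2 * c (alt W (i - k + 2 * m) a b)) + c (alt W (i + k) a b)"
    using product commute centred_sum_odd_kl_neighbours[OF assms(1,3), of i]
      c_alt_eq_kl[OF assms(1), of "i - k"]
    by simp
qed

end

theorem proposition4p4:
  fixes W :: "('w, 'm) monoid_scheme" and s1 s2 :: 'w
    and scale :: "laurent \<Rightarrow> 'h::ring_1 \<Rightarrow> 'h"
    and T :: "'w \<Rightarrow> 'h" and \<iota> :: "'h \<Rightarrow> 'h" and c :: "'w \<Rightarrow> 'h"
    and k i :: nat
  assumes "infinite_dihedral W s1 s2"
    and "kazhdan_lusztig_basis scale W {s1, s2} T \<iota> c"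
    and "k > 0" and "i > 0"
  shows "\<forall>(a, b) \<in> {(s1, s2), (s2, s1)}.
    let C = (\<lambda>j. c (alt W j a b));
        s = (if even k then a else b);
        t = (if even k then b else a)
    in (i < k \<longrightarrow> c (alt W i s t) * C k
          = C (k - i) + (\<Sum>m\<in>{1..<i}. 2 * C (k - i + 2 * m)) + C (k + i))
     \<and> (i = k \<longrightarrow> c (alt W i s t) * C k
          = (\<Sum>m\<in>{1..<k}. 2 * C (2 * m)) + C (2 * k))
     \<and> (i > k \<longrightarrow> c (alt W i s t) * C k
          = C (i - k) + (\<Sum>m\<in>{1..<k}. 2 * C (i - k + 2 * m)) + C (i + k))
     \<and> (i \<le> k \<longrightarrow> c (alt W i t s) * C k
          = (\<Sum>m\<in>{0..<i}. scale (v + v_inv) (C (k - i + 1 + 2 * m))))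
     \<and> (i \<ge> k \<longrightarrow> c (alt W i t s) * C k
          = (\<Sum>m\<in>{0..<k}. scale (v + v_inv) (C (i - k + 1 + 2 * m))))"
proof -
  interpret dihedral_kazhdan_lusztig scale W s1 s2 T \<iota> c
    using assms(1,2) by (rule dihedral_kazhdan_lusztig.intro)
  have letters: "letter a b (int k) = (if even k then a else b)"
    "letter a b (int k + 1) = (if even k then b else a)" for a b :: 'w
    by (simp_all add: letter_def)
  note products =
    c_alt_mult_other_letter[OF _ assms(4,3), unfolded letters]
    c_alt_mult_same_letter[OF _ assms(4,3), unfolded letters]
  show ?thesis
    unfolding Let_def case_prod_beta
    by (intro ballI conjI impI; rule products; (assumption | simp only: prod.collapse))
qed

end
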